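(* Let $G$ be a metrizable topological group (not necessarily abelian) which is not locally precompact. Then $$\mathrm{cof}(\mathrm{PK}(G))=\max\bigl(\mathfrak d,\ \mathrm d(G),\ \mathrm{cof}([\mathrm{ld}(G)]^{\aleph_0})\bigr).$$
   Context: A subset $A$ of a topological group $G$ is precompact if for each neighborhood $U$ of the identity there is a finite $F\subseteq G$ with $A\subseteq FU$. $\mathrm{PK}(G)$ is the family of all precompact subsets of $G$, ordered by inclusion. $G$ is locally precompact if the identity has a precompact neighborhood. $\mathrm d(X)$ is the density (minimal cardinality of a dense subset) of a space $X$; $\mathrm{ld}(G)$, the local density of $G$, is the minimal density of a neighborhood of the identity in $G$. For a partially ordered set $P$, $\mathrm{cof}(P)$ is the minimal cardinality of a cofinal subset of $P$. $\mathfrak d$ is the cofinality of $\mathbb N^{\mathbb N}$ ordered by $f\le g$ iff $f(n)\le g(n)$ for all $n$. For a cardinal $\lambda$, $[\lambda]^{\aleph_0}$ is the family of countably infinite subsets of $\lambda$, ordered by inclusion. *)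

theory Defs
  imports "HOL-Analysis.Analysis"
begin

unbundle cardinal_syntax

text \<open>
  Topological groups are types of class \<^class>\<open>topological_group_add\<close>. Despite the additive
  notation this class does not assume commutativity; the identity is 0 and the translate
  \<open>F U\<close> is the elementwise sum \<open>F + U\<close>. Neighborhoods need not be open: \<open>U\<close> is a
  neighborhood of the identity iff \<open>0 \<in> interior U\<close>.

  Cardinals are cardinal orders, and cardinals of different types are compared by
  \<open>\<le>o\<close> and \<open>=o\<close>.
\<close>

text \<open>Only determined up to \<open>=o\<close>, and meaningful only for nonempty sets of cardinals.\<close>

definition card_min :: "'a rel set \<Rightarrow> 'a rel" where
  "card_min R = (SOME r. r \<in> R \<and> (\<forall>s\<in>R. r \<le>o s))"

lemma card_min:
  assumes "R \<noteq> {}" and "\<And>r. r \<in> R \<Longrightarrow> Card_order r"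
  shows "card_min R \<in> R" and "\<And>s. s \<in> R \<Longrightarrow> card_min R \<le>o s"
proof -
  have "\<exists>r. r \<in> R \<and> (\<forall>s\<in>R. r \<le>o s)"
    using exists_minim_Card_order[of R] assms by blast
  then have "card_min R \<in> R \<and> (\<forall>s\<in>R. card_min R \<le>o s)"
    unfolding card_min_def by (rule someI_ex)
  then show "card_min R \<in> R" and "\<And>s. s \<in> R \<Longrightarrow> card_min R \<le>o s"
    by auto
qed

text \<open>The maximum of two cardinals, transported to the sum type since their types may differ.\<close>

definition card_max :: "'a rel \<Rightarrow> 'b rel \<Rightarrow> ('a + 'b) rel" where
  "card_max r s = (if r \<le>o s then |Inr ` Field s| else |Inl ` Field r| )"

lemma card_max_eq:
  assumes "Card_order r" "Card_order s"
  shows "r \<le>o s \<Longrightarrow> card_max r s =o s" and "s \<le>o r \<Longrightarrow> card_max r s =o r"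
proof -
  have l: "|Inl ` Field r :: ('a + 'b) set| =o r"
    by (rule ordIso_transitive[OF ordIso_symmetric[OF card_of_ordIsoI[of Inl]]
          card_of_Field_ordIso[OF assms(1)]]) (simp add: bij_betw_def)
  have s: "|Inr ` Field s :: ('a + 'b) set| =o s"
    by (rule ordIso_transitive[OF ordIso_symmetric[OF card_of_ordIsoI[of Inr]]
          card_of_Field_ordIso[OF assms(2)]]) (simp add: bij_betw_def)
  show "r \<le>o s \<Longrightarrow> card_max r s =o s"
    using s by (simp add: card_max_def)
  show "s \<le>o r \<Longrightarrow> card_max r s =o r"
    using l s by (auto simp: card_max_def ordIso_iff_ordLeq intro: ordLeq_transitive)
qed

definition topological_density :: "'a topology \<Rightarrow> 'a rel" where
  "topological_density X = card_min {|D| |D. D \<subseteq> topspace X \<and> X closure_of D = topspace X}"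

definition local_density :: "'a::topological_group_add itself \<Rightarrow> 'a rel" where
  "local_density _ = card_min {topological_density (top_of_set U) |U::'a set. 0 \<in> interior U}"

text \<open>
  The order on \<open>P\<close> is the one of the ambient type: inclusion for families of sets,
  the pointwise order for families of functions.
\<close>

definition cofinality :: "'a::order set \<Rightarrow> 'a rel" where
  "cofinality P = card_min {|C| |C. C \<subseteq> P \<and> (\<forall>p\<in>P. \<exists>c\<in>C. p \<le> c)}"

definition dominating_number :: "(nat \<Rightarrow> nat) rel" where
  "dominating_number = cofinality (UNIV :: (nat \<Rightarrow> nat) set)"

definition countably_infinite_subsets :: "'a set \<Rightarrow> 'a set set" where
  "countably_infinite_subsets S = {A. A \<subseteq> S \<and> countable A \<and> infinite A}"

definition precompact :: "'a::topological_group_add set \<Rightarrow> bool" where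
  "precompact A \<longleftrightarrow> (\<forall>U. 0 \<in> interior U \<longrightarrow> (\<exists>F. finite F \<and> A \<subseteq> F + U))"

definition locally_precompact :: "'a::topological_group_add itself \<Rightarrow> bool" where
  "locally_precompact _ \<longleftrightarrow> (\<exists>U::'a set. 0 \<in> interior U \<and> precompact U)"

end

theory Submission
  imports Defs
begin

text \<open>
  Fix a decreasing base \<open>V n\<close> of neighborhoods of 0 and a set \<open>E\<close> realizing the local density,
  dense in a neighborhood \<open>W\<close>. A precompact set meets a uniformly separated set in a finite set,
  and a set almost contained in every \<open>V n\<close> is precompact.

  Lower bounds. Since \<open>V n\<close> is not precompact, it contains an infinite separated sequence
  \<open>x n\<close>. The set of all \<open>x n i\<close> with \<open>i \<le> f n\<close> is precompact, while for precompact \<open>A\<close> the indices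
  \<open>i\<close> with \<open>x n i \<in> A\<close> are bounded for each \<open>n\<close>; this compares \<open>\<nat>\<^sup>\<nat>\<close> with the precompact sets.
  The finite sets witnessing precompactness of the members of a cofinal family have a dense union.
  By minimality of \<open>E\<close> there are injections \<open>j n\<close> of \<open>E\<close> into unions of countably many separated
  subsets of \<open>V n\<close>. If \<open>b\<close> enumerates a countable subset of \<open>E\<close>, then the \<open>j n (b n)\<close> converge to 0
  and so form a precompact set, while \<open>{a \<in> E. \<exists>n. j n a \<in> A}\<close> is countable for precompact \<open>A\<close>.

  Upper bound. Up to finitely many translations by elements of a dense set, a precompact set lies
  in \<open>W\<close>, hence for each \<open>n\<close> in \<open>K n + V n\<close> with \<open>K n \<subseteq> E\<close> finite. It is therefore
  determined, up to enlargement, by a countable \<open>B \<subseteq> E\<close> containing all \<open>K n\<close> and a function bounding the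
  positions of \<open>K n\<close> in an enumeration of \<open>B\<close>.
\<close>

section \<open>Cofinalities, maxima of cardinals and families of finite sets\<close>

lemma cofinality_eq:
  obtains C where "C \<subseteq> P" "\<And>p. p \<in> P \<Longrightarrow> \<exists>c\<in>C. p \<le> c" "cofinality P = |C|"
proof -
  let ?R = "{|C| |C. C \<subseteq> P \<and> (\<forall>p\<in>P. \<exists>c\<in>C. p \<le> c)}"
  have "|P| \<in> ?R"
    by blast
  then have "cofinality P \<in> ?R"
    unfolding cofinality_def by (intro card_min(1)) (use card_of_Card_order in auto)
  then show thesis
    using that by auto
qed

lemma cofinality_le:
  assumes "C \<subseteq> P" "\<And>p. p \<in> P \<Longrightarrow> \<exists>c\<in>C. p \<le> c"
  shows "cofinality P \<le>o |C|"
  unfolding cofinality_def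
  by (rule card_min(2)) (use assms card_of_Card_order in auto)

lemma card_max_ge:
  assumes "Card_order r" "Card_order s"
  shows "r \<le>o card_max r s" "s \<le>o card_max r s"
proof -
  have "r \<le>o card_max r s \<and> s \<le>o card_max r s"
  proof (cases "r \<le>o s")
    case True
    then have "s \<le>o card_max r s"
      using card_max_eq(1)[OF assms] ordIso_iff_ordLeq by blast
    then show ?thesis
      using True ordLeq_transitive by blast
  next
    case False
    then have "s \<le>o r"
      using ordLeq_total[OF assms(1,2)[THEN card_order_on_well_order_on]] by blast
    moreover from this have "r \<le>o card_max r s"
      using card_max_eq(2)[OF assms] ordIso_iff_ordLeq by blast
    ultimately show ?thesis
      using ordLeq_transitive by blast
  qed
  then show "r \<le>o card_max r s" "s \<le>o card_max r s"
    by auto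
qed

lemma card_max_le:
  assumes "Card_order r" "Card_order s" "r \<le>o t" "s \<le>o t"
  shows "card_max r s \<le>o t"
proof (cases "r \<le>o s")
  case True
  then show ?thesis
    using card_max_eq(1)[OF assms(1,2)] assms(4) ordIso_ordLeq_trans by blast
next
  case False
  then have "s \<le>o r"
    using ordLeq_total[OF assms(1,2)[THEN card_order_on_well_order_on]] by blast
  then show ?thesis
    using card_max_eq(2)[OF assms(1,2)] assms(3) ordIso_ordLeq_trans by blast
qed

text \<open>Finite subsets are sets of lists. Since an infinite cardinal absorbs its square, the
  lists of each fixed length number at most \<open>|A|\<close>, and so does their union over all
  lengths.\<close>

lemma card_of_Fpow_le:
  assumes "infinite A"
  shows "|Fpow A| \<le>o |A|"
proof -
  define L where "L n = {xs. set xs \<subseteq> A \<and> length xs = n}" for n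
  have "|L n| \<le>o |A|" for n
  proof (induction n)
    case 0
    have "L 0 = {[]}"
      by (auto simp: L_def)
    then show ?case
      using assms card_of_singl_ordLeq[of A "[]"] by auto
  next
    case (Suc n)
    have "L (Suc n) = (\<lambda>(x, xs). x # xs) ` (A \<times> L n)"
      by (force simp: L_def length_Suc_conv)
    then have "|L (Suc n)| \<le>o |A \<times> L n|"
      using card_of_image[of "\<lambda>(x, xs). x # xs" "A \<times> L n"] by simp
    moreover have "|A \<times> L n| \<le>o |A|"
      using assms Suc card_of_Card_order[of A]
      by (intro card_of_Times_ordLeq_infinite_Field) (auto simp: Field_card_of ordLeq_refl)
    ultimately show ?case
      by (rule ordLeq_transitive)
  qed
  then have "|\<Union>n. L n| \<le>o |A|"
    using assms infinite_iff_card_of_nat by (intro card_of_UNION_ordLeq_infinite) auto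
  then have "|set ` (\<Union>n. L n)| \<le>o |A|"
    by (rule ordLeq_transitive[OF card_of_image])
  moreover have "Fpow A \<subseteq> set ` (\<Union>n. L n)"
  proof
    fix F
    assume F: "F \<in> Fpow A"
    then obtain xs where "set xs = F"
      using finite_list[of F] by (auto simp: Fpow_def)
    with F show "F \<in> set ` (\<Union>n. L n)"
      by (auto simp: Fpow_def L_def)
  qed
  ultimately show ?thesis
    by (rule ordLeq_transitive[OF card_of_mono1, rotated])
qed

lemma Card_order_card_max: "Card_order (card_max r s)"
  by (simp add: card_max_def card_of_Card_order)

section \<open>Neighborhoods of 0, closure and density in topological groups\<close>

text \<open>Continuity of \<open>u - v + w\<close> at the origin, with the order of the summands
  kept because the group may be noncommutative. It serves to move the centers of a cover and to
  compare two points of one translate.\<close>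

lemma open_zero_split:
  fixes U :: "'a::topological_group_add set"
  assumes "open U" "0 \<in> U"
  obtains V where "open V" "0 \<in> V" "\<And>u v w. u \<in> V \<Longrightarrow> v \<in> V \<Longrightarrow> w \<in> V \<Longrightarrow> u - v + w \<in> U"
proof -
  define f where "f = (\<lambda>p::'a \<times> 'a \<times> 'a. fst p + - fst (snd p) + snd (snd p))"
  have "continuous_on UNIV f"
    unfolding f_def continuous_on_def by (intro ballI tendsto_intros)
  then have "open (f -` U)"
    using assms(1) by (simp add: open_vimage)
  moreover have "(0, 0, 0) \<in> f -` U"
    using assms(2) by (simp add: f_def)
  ultimately obtain A B where AB: "open A" "0 \<in> A" "open B" "(0, 0) \<in> B" "A \<times> B \<subseteq> f -` U"
    by (rule open_prod_elim) auto
  from AB(3,4) obtain B1 B2 where B: "open B1" "0 \<in> B1" "open B2" "0 \<in> B2" "B1 \<times> B2 \<subseteq> B"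
    by (rule open_prod_elim) auto
  show thesis
  proof (rule that[of "A \<inter> B1 \<inter> B2"])
    fix u v w
    assume "u \<in> A \<inter> B1 \<inter> B2" "v \<in> A \<inter> B1 \<inter> B2" "w \<in> A \<inter> B1 \<inter> B2"
    then have "(u, v, w) \<in> f -` U"
      using AB(5) B(5) by blast
    then show "u - v + w \<in> U"
      by (simp add: f_def)
  qed (use AB B in auto)
qed

lemma open_vimage_translate:
  fixes U :: "'a::topological_group_add set"
  assumes "open U"
  shows "open {y. - y + x \<in> U}" "open {y. x - y \<in> U}" "open {y. - y \<in> U}"
proof -
  have "continuous_on UNIV (\<lambda>y::'a. - y + x)" "continuous_on UNIV (\<lambda>y::'a. x + - y)"
    "continuous_on UNIV (\<lambda>y::'a. - y)"
    unfolding continuous_on_def by (intro ballI tendsto_intros)+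
  from this[THEN open_vimage[OF assms]]
  show "open {y. - y + x \<in> U}" "open {y. x - y \<in> U}" "open {y. - y \<in> U}"
    by (simp_all add: vimage_def)
qed

text \<open>The sets \<open>{y. - y + x \<in> U}\<close> form a neighborhood base at
  \<open>x\<close>, so closure can be tested with the left translates that occur in
  precompactness.\<close>

lemma closure_iff_set_plus:
  fixes D :: "'a::topological_group_add set"
  shows "x \<in> closure D \<longleftrightarrow> (\<forall>U. open U \<longrightarrow> 0 \<in> U \<longrightarrow> x \<in> D + U)"
proof (intro iffI allI impI)
  fix U :: "'a set"
  assume x: "x \<in> closure D" and U: "open U" "0 \<in> U"
  have "open {y. - y + x \<in> U}" "x \<in> {y. - y + x \<in> U}"
    using U open_vimage_translate by auto
  then have "D \<inter> {y. - y + x \<in> U} \<noteq> {}"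
    using x unfolding closure_iff_nhds_not_empty by blast
  then obtain d where "d \<in> D" "- d + x \<in> U"
    by auto
  then have "d + (- d + x) \<in> D + U"
    by (rule set_plus_intro)
  then show "x \<in> D + U"
    by (simp add: add.assoc[symmetric])
next
  assume *: "\<forall>U. open U \<longrightarrow> 0 \<in> U \<longrightarrow> x \<in> D + U"
  have "D \<inter> T \<noteq> {}" if T: "open T" "x \<in> T" for T
  proof -
    \<comment> \<open>Chosen so that \<open>x = d + u\<close> with \<open>u\<close> in this set
      gives \<open>d = x - u \<in> T\<close>.\<close>
    have "open {y. x - y \<in> T}" "0 \<in> {y. x - y \<in> T}"
      using T open_vimage_translate by auto
    then have "x \<in> D + {y. x - y \<in> T}"
      using * by blast
    then obtain d u where "d \<in> D" "x - u \<in> T" "x = d + u"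
      by (auto elim: set_plus_elim)
    then show ?thesis
      by auto
  qed
  then show "x \<in> closure D"
    by (auto simp: closure_iff_nhds_not_empty)
qed

lemma closure_subset_set_plus:
  fixes D :: "'a::topological_group_add set"
  shows "open U \<Longrightarrow> 0 \<in> U \<Longrightarrow> closure D \<subseteq> D + U"
  using closure_iff_set_plus by blast

lemma dense_in_top_of_set_iff:
  "D \<subseteq> S \<and> top_of_set S closure_of D = S \<longleftrightarrow> D \<subseteq> S \<and> S \<subseteq> closure D"
  by (auto simp: closure_of_subtopology Int_absorb1 Int_absorb2)

lemma topological_density_eq:
  obtains D where "D \<subseteq> S" "S \<subseteq> closure D" "topological_density (top_of_set S) = |D|"
proof -
  let ?R = "{|D| |D. D \<subseteq> S \<and> top_of_set S closure_of D = S}"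
  have "S \<subseteq> S \<and> top_of_set S closure_of S = S"
    unfolding dense_in_top_of_set_iff using closure_subset by blast
  then have "?R \<noteq> {}"
    by blast
  then have "card_min ?R \<in> ?R"
    by (intro card_min(1)) (use card_of_Card_order in auto)
  then show thesis
    using that dense_in_top_of_set_iff[of _ S] unfolding topological_density_def by auto
qed

lemma topological_density_le:
  assumes "D \<subseteq> S" "S \<subseteq> closure D"
  shows "topological_density (top_of_set S) \<le>o |D|"
  unfolding topological_density_def
  by (rule card_min(2)) (use assms dense_in_top_of_set_iff[of D S] card_of_Card_order in auto)

text \<open>Both minima are attained, first over neighborhoods and then over dense subsets. The last
  clause lets \<open>E\<close> be compared with a dense subset of any other neighborhood.\<close>

lemma local_density_eq:
  obtains W E :: "'a::topological_group_add set"
  where "0 \<in> interior W" "E \<subseteq> W" "W \<subseteq> closure E" "local_density TYPE('a) = |E|"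
    "\<And>U D :: 'a set. \<lbrakk>0 \<in> interior U; D \<subseteq> U; U \<subseteq> closure D\<rbrakk> \<Longrightarrow> |E| \<le>o |D|"
proof -
  let ?R = "{topological_density (top_of_set U) |U::'a set. 0 \<in> interior U}"
  have card: "Card_order r" if r: "r \<in> ?R" for r
  proof -
    obtain U where "r = topological_density (top_of_set U)"
      using r by blast
    moreover obtain D where "topological_density (top_of_set U) = |D|"
      by (rule topological_density_eq)
    ultimately show ?thesis
      by (simp add: card_of_Card_order)
  qed
  have "topological_density (top_of_set UNIV) \<in> ?R"
    using interior_UNIV by blast
  then have "?R \<noteq> {}"
    by blast
  note min = card_min[of ?R, OF this card]
  have ld: "local_density TYPE('a) = card_min ?R"
    by (simp add: local_density_def)
  obtain W :: "'a set" where W: "0 \<in> interior W"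
    "local_density TYPE('a) = topological_density (top_of_set W)"
    using min(1) ld by auto
  obtain E where E: "E \<subseteq> W" "W \<subseteq> closure E" "topological_density (top_of_set W) = |E|"
    by (rule topological_density_eq)
  show thesis
  proof (rule that[OF W(1) E(1,2)])
    show "local_density TYPE('a) = |E|"
      using W(2) E(3) by simp
    fix U D :: "'a set"
    assume "0 \<in> interior U" "D \<subseteq> U" "U \<subseteq> closure D"
    then show "|E| \<le>o |D|"
      using min(2)[of "topological_density (top_of_set U)"] topological_density_le[of D U] W(2) E(3) ld
      by (auto intro: ordLeq_transitive)
  qed
qed

section \<open>Precompact sets and separated sets\<close>

lemma precompactD:
  assumes "precompact A" "open U" "0 \<in> U"
  obtains F where "finite F" "A \<subseteq> F + U"
  using assms unfolding precompact_def by (metis interior_open)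

lemma precompactI:
  fixes A :: "'a::topological_group_add set"
  assumes "\<And>U. open U \<Longrightarrow> 0 \<in> U \<Longrightarrow> \<exists>F. finite F \<and> A \<subseteq> F + U"
  shows "precompact A"
  unfolding precompact_def
proof (intro allI impI)
  fix U :: "'a set"
  assume "0 \<in> interior U"
  then obtain F where "finite F" "A \<subseteq> F + interior U"
    using assms[of "interior U"] by auto
  then show "\<exists>F. finite F \<and> A \<subseteq> F + U"
    using interior_subset[of U] set_plus_mono2[of F F] by blast
qed

lemma precompact_subset: "precompact A \<Longrightarrow> B \<subseteq> A \<Longrightarrow> precompact B"
  unfolding precompact_def by (meson order_trans)

lemma precompact_set_plus_finite:
  fixes A :: "'a::topological_group_add set"
  assumes "finite F" "precompact A"
  shows "precompact (F + A)"
proof (rule precompactI)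
  fix U :: "'a set"
  assume "open U" "0 \<in> U"
  then obtain H where "finite H" "A \<subseteq> H + U"
    using assms(2) precompactD by blast
  then have "F + A \<subseteq> (F + H) + U" "finite (F + H)"
    using set_plus_mono2[of F F A "H + U"] assms(1) by (auto simp: add.assoc finite_set_plus)
  then show "\<exists>H. finite H \<and> F + A \<subseteq> H + U"
    by blast
qed

text \<open>A center \<open>h\<close> whose small translate meets \<open>A\<close> at a point
  \<open>h + v\<close> can be replaced by an element of \<open>D\<close> close to that point, at the
  cost of enlarging the small neighborhood \<open>V\<close> to \<open>U\<close>.\<close>

lemma precompact_dense_cover:
  fixes A :: "'a::topological_group_add set"
  assumes A: "precompact A" and D: "A \<subseteq> closure D" and U: "open U" "0 \<in> U"
  obtains F where "finite F" "F \<subseteq> D" "A \<subseteq> F + U"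
proof -
  obtain V where V: "open V" "0 \<in> V" "\<And>u v w. u \<in> V \<Longrightarrow> v \<in> V \<Longrightarrow> w \<in> V \<Longrightarrow> u - v + w \<in> U"
    using U by (rule open_zero_split) auto
  obtain H where H: "finite H" "A \<subseteq> H + V"
    using A V(1,2) by (rule precompactD)
  have "\<exists>d\<in>D. \<forall>u\<in>V. h + u \<in> A \<longrightarrow> - d + (h + u) \<in> U" if ex: "\<exists>u\<in>V. h + u \<in> A" for h
  proof -
    obtain v where v: "v \<in> V" "h + v \<in> A"
      using ex by blast
    then have "h + v \<in> D + V"
      using D closure_subset_set_plus[OF V(1,2)] by blast
    then obtain d w where w: "d \<in> D" "w \<in> V" "h + v = d + w"
      by (rule set_plus_elim)
    \<comment> \<open>Solving for \<open>h\<close> turns \<open>- d + (h + u)\<close> into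
      \<open>w - v + u\<close>, which lies in \<open>U\<close> for all \<open>u \<in> V\<close> at
      once; hence \<open>d\<close> does not depend on \<open>u\<close>.\<close>
    then have "h = d + (w - v)"
      by (metis add.assoc add_diff_cancel diff_conv_add_uminus)
    then have "- d + (h + u) = w - v + u" for u
      by (simp add: add.assoc[symmetric])
    then have "- d + (h + u) \<in> U" if "u \<in> V" for u
      using V(3)[OF w(2) v(1) that] by simp
    then show ?thesis
      using w(1) by blast
  qed
  then obtain d where d: "\<And>h. \<exists>u\<in>V. h + u \<in> A \<Longrightarrow> d h \<in> D \<and> (\<forall>u\<in>V. h + u \<in> A \<longrightarrow> - d h + (h + u) \<in> U)"
    by metis
  \<comment> \<open>Centers whose translate misses \<open>A\<close> are discarded, since
    \<open>d\<close> is only controlled on the others.\<close>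
  define F where "F = d ` {h \<in> H. \<exists>u\<in>V. h + u \<in> A}"
  show thesis
  proof (rule that)
    show "finite F" "F \<subseteq> D"
      using H(1) d by (auto simp: F_def)
    show "A \<subseteq> F + U"
    proof
      fix x
      assume x: "x \<in> A"
      then obtain h u where hu: "h \<in> H" "u \<in> V" "x = h + u"
        using H(2) by (blast elim: set_plus_elim)
      then have "d h \<in> F" "- d h + x \<in> U"
        using d[of h] x unfolding F_def by blast+
      then have "d h + (- d h + x) \<in> F + U"
        by (rule set_plus_intro)
      then show "x \<in> F + U"
        by (simp add: add.assoc[symmetric])
    qed
  qed
qed

text \<open>Take a maximal separated subset of \<open>V\<close> by Zorn's lemma. Maximality yields
  the cover. A precompact set is covered by finitely many translates so small that each contains at
  most one point of \<open>S\<close>.\<close>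

lemma maximal_separated:
  fixes V :: "'a::topological_group_add set"
  assumes U: "open U" "0 \<in> U"
  obtains S where "S \<subseteq> V" "V \<subseteq> S + U" "\<And>A. precompact A \<Longrightarrow> finite (A \<inter> S)"
proof -
  \<comment> \<open>Symmetrizing makes separation a symmetric relation, because
    \<open>- x + y\<close> and \<open>- y + x\<close> are inverse to each other.\<close>
  define U' where "U' = U \<inter> {y. - y \<in> U}"
  have U': "open U'" "0 \<in> U'" "U' \<subseteq> U" "\<And>x. x \<in> U' \<Longrightarrow> - x \<in> U'"
    using U open_vimage_translate(3)[OF U(1)] by (auto simp: U'_def)
  define \<S> where "\<S> = {S. S \<subseteq> V \<and> (\<forall>x\<in>S. \<forall>y\<in>S. x \<noteq> y \<longrightarrow> - x + y \<notin> U')}"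
  have "\<Union>\<C> \<in> \<S>" if "\<C> \<in> chains \<S>" for \<C>
  proof -
    have sub: "\<C> \<subseteq> \<S>" and tot: "\<And>S T. S \<in> \<C> \<Longrightarrow> T \<in> \<C> \<Longrightarrow> S \<subseteq> T \<or> T \<subseteq> S"
      using that by (auto simp: chains_def chain_subset_def)
    have "- x + y \<notin> U'" if "x \<in> S" "S \<in> \<C>" "y \<in> T" "T \<in> \<C>" "x \<noteq> y" for x y S T
    proof -
      have "S \<in> \<S>" "T \<in> \<S>"
        using that sub by blast+
      then show ?thesis
        using tot[of S T] that unfolding \<S>_def by blast
    qed
    then show ?thesis
      using sub by (auto simp: \<S>_def)
  qed
  then obtain S where S: "S \<in> \<S>" "\<And>X. X \<in> \<S> \<Longrightarrow> S \<subseteq> X \<Longrightarrow> X = S"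
    using Zorn_Lemma[of \<S>] by auto
  show thesis
  proof (rule that)
    show "S \<subseteq> V"
      using S(1) by (simp add: \<S>_def)
    show "V \<subseteq> S + U"
    proof
      fix v
      assume v: "v \<in> V"
      have "\<exists>x\<in>S. - x + v \<in> U'"
      proof (cases "v \<in> S")
        case True
        then show ?thesis
          using U'(2) by force
      next
        case False
        then have "insert v S \<notin> \<S>"
          using S(2) by blast
        then obtain x where "x \<in> S" "- x + v \<in> U' \<or> - v + x \<in> U'"
          using S(1) v by (auto simp: \<S>_def)
        moreover have "- (- v + x) = - x + v"
          by (simp add: minus_add)
        ultimately show ?thesis
          using U'(4) by metis
      qed
      then obtain x where "x \<in> S" "- x + v \<in> U"
        using U'(3) by blast
      then have "x + (- x + v) \<in> S + U"
        by (rule set_plus_intro)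
      then show "v \<in> S + U"
        by (simp add: add.assoc[symmetric])
    qed
    fix A :: "'a set"
    assume A: "precompact A"
    obtain W where W: "open W" "0 \<in> W" "\<And>u v w. u \<in> W \<Longrightarrow> v \<in> W \<Longrightarrow> w \<in> W \<Longrightarrow> u - v + w \<in> U'"
      using U'(1,2) by (rule open_zero_split) auto
    obtain F where F: "finite F" "A \<subseteq> F + W"
      using A W(1,2) by (rule precompactD)
    have "\<exists>f\<in>F. - f + x \<in> W" if "x \<in> A" for x
    proof -
      have "x \<in> F + W"
        using that F(2) by blast
      then obtain f w where fw: "f \<in> F" "w \<in> W" "x = f + w"
        by (rule set_plus_elim)
      then have "- f + x = w"
        by (simp add: add.assoc[symmetric])
      then show ?thesis
        using fw by blast
    qed
    then obtain f where f: "\<And>x. x \<in> A \<Longrightarrow> f x \<in> F \<and> - f x + x \<in> W"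
      by metis
    have "inj_on f (A \<inter> S)"
    proof (rule inj_onI)
      fix x y
      assume xy: "x \<in> A \<inter> S" "y \<in> A \<inter> S" "f x = f y"
      \<comment> \<open>For two points in the same translate the center cancels and leaves
        \<open>- x + y\<close>, so separation forces \<open>x = y\<close>.\<close>
      have "0 - (- f x + x) + (- f x + y) \<in> U'"
        using f[of x] f[of y] xy W(2) by (intro W(3)) auto
      moreover have "0 - (- f x + x) + (- f x + y) = - x + y"
        by (simp add: minus_add add.assoc)
      ultimately show "x = y"
        using S(1) xy by (auto simp: \<S>_def)
    qed
    moreover have "finite (f ` (A \<inter> S))"
      using f F(1) by (auto intro: finite_subset)
    ultimately show "finite (A \<inter> S)"
      by (rule finite_imageD[rotated])
  qed
qed

section \<open>Countable decreasing neighborhood bases at 0\<close>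

locale countable_zero_base =
  fixes V :: "nat \<Rightarrow> 'a::topological_group_add set"
  assumes open_V: "open (V n)"
    and zero_in_V: "0 \<in> V n"
    and V_antimono: "m \<le> n \<Longrightarrow> V n \<subseteq> V m"
    and V_base: "open U \<Longrightarrow> 0 \<in> U \<Longrightarrow> \<exists>n. V n \<subseteq> U"

lemma metrizable_countable_zero_base:
  assumes "metrizable_space (euclidean :: 'a::topological_group_add topology)"
  obtains V :: "nat \<Rightarrow> 'a::topological_group_add set" where "countable_zero_base V"
proof -
  obtain \<B> :: "'a set set" where \<B>: "countable \<B>" "\<forall>V\<in>\<B>. open V"
    "\<forall>U. open U \<and> 0 \<in> U \<longrightarrow> (\<exists>V\<in>\<B>. 0 \<in> V \<and> V \<subseteq> U)"
    using metrizable_imp_first_countable[OF assms] unfolding first_countable_def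
    by (metis UNIV_I open_openin topspace_euclidean)
  \<comment> \<open>\<open>UNIV\<close> ensures nonemptiness, so that every value of
    \<open>from_nat_into \<D>\<close> lies in \<open>\<D>\<close>; the finite intersections below
    make the base decreasing.\<close>
  define \<D> where "\<D> = insert UNIV {V \<in> \<B>. 0 \<in> V}"
  have \<D>: "countable \<D>" "\<D> \<noteq> {}"
    using \<B>(1) by (auto simp: \<D>_def)
  define V where "V n = (\<Inter>i\<le>n. from_nat_into \<D> i)" for n
  have mem: "open (from_nat_into \<D> i) \<and> 0 \<in> from_nat_into \<D> i" for i
    using from_nat_into[OF \<D>(2), of i] \<B>(2) by (auto simp: \<D>_def)
  have "\<exists>n. V n \<subseteq> U" if U: "open U" "0 \<in> U" for U
  proof -
    obtain W where W: "W \<in> \<D>" "W \<subseteq> U"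
      using \<B>(3) U by (auto simp: \<D>_def)
    then obtain n where "from_nat_into \<D> n = W"
      using from_nat_into_surj[OF \<D>(1)] by blast
    then have "V n \<subseteq> U"
      using W(2) by (auto simp: V_def)
    then show ?thesis ..
  qed
  then have "countable_zero_base V"
    using mem by unfold_locales (auto simp: V_def)
  then show thesis
    by (rule that)
qed

context countable_zero_base
begin

lemma precompactI_base:
  assumes "\<And>n. \<exists>F. finite F \<and> A \<subseteq> F + V n"
  shows "precompact A"
proof (rule precompactI)
  fix U :: "'a set"
  assume "open U" "0 \<in> U"
  then obtain n where "V n \<subseteq> U"
    using V_base by blast
  then have "F + V n \<subseteq> F + U" for F
    by (intro set_plus_mono2) auto
  then show "\<exists>F. finite F \<and> A \<subseteq> F + U"
    using assms[of n] by blast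
qed

text \<open>The center 0 covers the points in \<open>V n\<close>, and the finitely many others are
  their own centers. This is how sets built from sequences tending to 0 are seen to be
  precompact.\<close>

lemma precompact_if_finite_diff:
  assumes "\<And>n. finite (A - V n)"
  shows "precompact A"
proof (rule precompactI_base)
  fix n
  have "A \<subseteq> insert 0 (A - V n) + V n"
  proof
    fix x
    assume "x \<in> A"
    then show "x \<in> insert 0 (A - V n) + V n"
      using set_plus_intro[of x "insert 0 (A - V n)" 0 "V n"]
        set_plus_intro[of 0 "insert 0 (A - V n)" x "V n"] zero_in_V[of n]
      by (cases "x \<in> V n") auto
  qed
  then show "\<exists>F. finite F \<and> A \<subseteq> F + V n"
    using assms[of n] by (intro exI[of _ "insert 0 (A - V n)"]) auto
qed

lemma subset_closure_base:
  assumes "\<And>n. X \<subseteq> D + V n"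
  shows "X \<subseteq> closure D"
proof
  fix x
  assume x: "x \<in> X"
  have "x \<in> D + U" if U: "open U" "0 \<in> U" for U
  proof -
    obtain n where "V n \<subseteq> U"
      using V_base U by blast
    then have "D + V n \<subseteq> D + U"
      by (intro set_plus_mono2) auto
    then show ?thesis
      using assms[of n] x by blast
  qed
  then show "x \<in> closure D"
    by (simp add: closure_iff_set_plus)
qed

text \<open>The union over \<open>k\<close> of maximal \<open>V k\<close>-separated subsets of
  \<open>X\<close> is dense in \<open>X\<close>, and a precompact set meets each of them in a finite
  set.\<close>

lemma dense_with_countable_traces:
  fixes X :: "'a set"
  obtains T where "T \<subseteq> X" "X \<subseteq> closure T" "\<And>A. precompact A \<Longrightarrow> countable (A \<inter> T)"
proof -
  have "\<exists>S\<subseteq>X. X \<subseteq> S + V k \<and> (\<forall>A. precompact A \<longrightarrow> finite (A \<inter> S))" for k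
    using maximal_separated[OF open_V[of k] zero_in_V[of k], of X] by metis
  then obtain S where S: "\<And>k. S k \<subseteq> X" "\<And>k. X \<subseteq> S k + V k"
    "\<And>k A. precompact A \<Longrightarrow> finite (A \<inter> S k)"
    by metis
  show thesis
  proof (rule that)
    show "(\<Union>k. S k) \<subseteq> X"
      using S(1) by blast
    have "S k + V k \<subseteq> (\<Union>k. S k) + V k" for k
      by (intro set_plus_mono2) auto
    then show "X \<subseteq> closure (\<Union>k. S k)"
      using S(2) by (intro subset_closure_base) blast
    show "countable (A \<inter> (\<Union>k. S k))" if "precompact A" for A
      unfolding Int_UN_distrib using countable_finite[OF S(3)[OF that]] by (intro countable_UN) auto
  qed
qed

section \<open>Lower bounds for an arbitrary cofinal family \<open>C\<close> of precompact
  sets\<close>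

context
  fixes C :: "'a set set"
  assumes C_precompact: "\<And>A. A \<in> C \<Longrightarrow> precompact A"
    and C_cofinal: "\<And>A. precompact A \<Longrightarrow> \<exists>B\<in>C. A \<subseteq> B"
begin

text \<open>A Tukey comparison: a function \<open>f\<close> becomes a precompact set
  \<open>A\<close>, each \<open>B \<in> C\<close> becomes a function \<open>g B\<close>, and
  \<open>A \<subseteq> B\<close> forces \<open>f \<le> g B\<close>.\<close>

lemma dominating_number_le:
  assumes "\<not> locally_precompact TYPE('a)"
  shows "dominating_number \<le>o |C|"
proof -
  have "\<exists>S\<subseteq>V n. infinite S \<and> (\<forall>A. precompact A \<longrightarrow> finite (A \<inter> S))" for n
  proof -
    have "0 \<in> interior (V n)"
      using open_V zero_in_V by (simp add: interior_open)
    then have "\<not> precompact (V n)"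
      using assms unfolding locally_precompact_def by blast
    then obtain U where U: "open U" "0 \<in> U" "\<nexists>F. finite F \<and> V n \<subseteq> F + U"
      using precompactI[of "V n"] by metis
    \<comment> \<open>\<open>S\<close> must be infinite, since \<open>U\<close> was chosen so that
      no finite set of centers covers \<open>V n\<close>.\<close>
    obtain S where "S \<subseteq> V n" "V n \<subseteq> S + U" "\<And>A. precompact A \<Longrightarrow> finite (A \<inter> S)"
      using maximal_separated[OF U(1,2), of "V n"] by metis
    then show ?thesis
      using U(3) by blast
  qed
  then obtain S where S: "\<And>n. S n \<subseteq> V n" "\<And>n. infinite (S n)"
    "\<And>n A. precompact A \<Longrightarrow> finite (A \<inter> S n)"
    by metis
  have "\<exists>x :: nat \<Rightarrow> 'a. inj x \<and> range x \<subseteq> S n" for n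
    using infinite_countable_subset[OF S(2)] .
  then obtain x :: "nat \<Rightarrow> nat \<Rightarrow> 'a" where x: "\<And>n. inj (x n)" "\<And>n. range (x n) \<subseteq> S n"
    by metis
  have "\<exists>m. \<forall>i. x n i \<in> A \<longrightarrow> i \<le> m" if "A \<in> C" for A n
  proof -
    have "finite (x n -` (A \<inter> S n))"
      using S(3) C_precompact that x(1) by (intro finite_vimageI) auto
    then have "\<forall>i\<in>x n -` (A \<inter> S n). i \<le> Max (x n -` (A \<inter> S n))"
      by simp
    then show ?thesis
      using x(2) by blast
  qed
  then obtain g where g: "\<And>A n i. A \<in> C \<Longrightarrow> x n i \<in> A \<Longrightarrow> i \<le> g A n"
    by metis
  have "dominating_number \<le>o |g ` C|"
    unfolding dominating_number_def
  proof (rule cofinality_le)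
    fix f :: "nat \<Rightarrow> nat"
    define A where "A = (\<Union>n. x n ` {..f n})"
    have "precompact A"
    proof (rule precompact_if_finite_diff)
      fix k
      \<comment> \<open>Only the levels \<open>n < k\<close> can leave \<open>V k\<close>, and each
        contributes finitely many points.\<close>
      have "x n i \<in> V k" if "k \<le> n" for n i
        using x(2)[of n] S(1)[of n] V_antimono[OF that] by blast
      then have "A - V k \<subseteq> (\<Union>n<k. x n ` {..f n})"
        unfolding A_def using not_le by blast
      then show "finite (A - V k)"
        by (rule finite_subset) auto
    qed
    then obtain B where B: "B \<in> C" "A \<subseteq> B"
      using C_cofinal by blast
    then have "f \<le> g B"
      using g[OF B(1)] by (auto simp: le_fun_def A_def)
    then show "\<exists>h\<in>g ` C. f \<le> h"
      using B(1) by blast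
  qed simp
  then show ?thesis
    using card_of_image by (rule ordLeq_transitive)
qed

text \<open>Each member of \<open>C\<close> contributes countably many centers. As \<open>C\<close>
  is infinite, all of them together number at most \<open>|C|\<close>.\<close>

lemma topological_density_le_cofinal:
  assumes "\<not> locally_precompact TYPE('a)"
  shows "topological_density (euclidean :: 'a topology) \<le>o |C|"
proof -
  have "\<exists>F. finite F \<and> A \<subseteq> F + V n" if "A \<in> C" for A n
    using C_precompact[OF that] open_V zero_in_V precompactD by meson
  then obtain F where F: "\<And>A n. A \<in> C \<Longrightarrow> finite (F A n)" "\<And>A n. A \<in> C \<Longrightarrow> A \<subseteq> F A n + V n"
    by metis
  define D where "D = (\<Union>A\<in>C. \<Union>n. F A n)"
  \<comment> \<open>Singletons are precompact, so the members of \<open>C\<close> cover the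
    group.\<close>
  have cover: "UNIV \<subseteq> (\<Union>A\<in>C. F A n) + V n" for n
  proof
    fix g :: 'a
    have "precompact {g}"
      by (rule precompact_if_finite_diff) simp
    then obtain A where "A \<in> C" "g \<in> A"
      using C_cofinal by blast
    moreover from \<open>A \<in> C\<close> have "F A n + V n \<subseteq> (\<Union>A\<in>C. F A n) + V n"
      by (intro set_plus_mono2) auto
    ultimately show "g \<in> (\<Union>A\<in>C. F A n) + V n"
      using F(2) by blast
  qed
  \<comment> \<open>Otherwise finitely many centers would suffice for each \<open>n\<close>, and the
    whole group would be a precompact neighborhood of 0.\<close>
  have infinite: "infinite C"
  proof
    assume "finite C"
    then have "finite (\<Union>A\<in>C. F A n)" for n
      using F(1) by blast
    then have "precompact (UNIV :: 'a set)"
      using cover by (intro precompactI_base) blast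
    then show False
      using assms by (auto simp: locally_precompact_def)
  qed
  have "(\<Union>A\<in>C. F A n) + V n \<subseteq> D + V n" for n
    by (intro set_plus_mono2) (auto simp: D_def)
  with cover have "UNIV \<subseteq> D + V n" for n
    by (rule order_trans)
  then have "topological_density (top_of_set (UNIV :: 'a set)) \<le>o |D|"
    by (intro topological_density_le subset_closure_base subset_UNIV)
  moreover have "|D| \<le>o |C|"
    unfolding D_def
  proof (rule card_of_UNION_ordLeq_infinite[OF infinite ordIso_imp_ordLeq[OF card_of_refl]], rule ballI)
    fix A
    assume "A \<in> C"
    then have "countable (\<Union>n. F A n)"
      using F(1) by (intro countable_UN) (auto intro: countable_finite)
    then have "|\<Union>n. F A n| \<le>o |UNIV :: nat set|"
      unfolding countable_def card_of_ordLeq[symmetric] by simp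
    moreover have "|UNIV :: nat set| \<le>o |C|"
      using infinite infinite_iff_card_of_nat by blast
    ultimately show "|\<Union>n. F A n| \<le>o |C|"
      by (rule ordLeq_transitive)
  qed
  ultimately have "topological_density (top_of_set (UNIV :: 'a set)) \<le>o |C|"
    using ordLeq_transitive by blast
  then show ?thesis
    by simp
qed

text \<open>Minimality of \<open>E\<close> embeds it into sets \<open>T n\<close> dense in
  \<open>V n\<close>; their countable traces on precompact sets keep each \<open>\<phi> A\<close>
  countable.\<close>

lemma cofinality_countable_subsets_le:
  fixes E :: "'a set"
  assumes E: "\<And>U D :: 'a set. \<lbrakk>0 \<in> interior U; D \<subseteq> U; U \<subseteq> closure D\<rbrakk> \<Longrightarrow> |E| \<le>o |D|"
    and "infinite E"
  shows "cofinality (countably_infinite_subsets E) \<le>o |C|"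
proof -
  have "\<exists>T::'a set. T \<subseteq> V n \<and> V n \<subseteq> closure T \<and> (\<forall>A. precompact A \<longrightarrow> countable (A \<inter> T))" for n
    using dense_with_countable_traces[of "V n"] by metis
  then obtain T :: "nat \<Rightarrow> 'a set" where T: "\<And>n. T n \<subseteq> V n" "\<And>n. V n \<subseteq> closure (T n)"
    "\<And>n A. precompact A \<Longrightarrow> countable (A \<inter> T n)"
    by metis
  have "0 \<in> interior (V n)" for n
    using open_V zero_in_V by (simp add: interior_open)
  then have "|E| \<le>o |T n|" for n
    using E[of "V n" "T n"] T(1,2) by blast
  then have "\<exists>j. inj_on j E \<and> j ` E \<subseteq> T n" for n
    by (simp add: card_of_ordLeq)
  then obtain j where j: "\<And>n. inj_on (j n) E" "\<And>n. j n ` E \<subseteq> T n"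
    by metis
  \<comment> \<open>\<open>\<phi> A\<close> may be finite; joining \<open>E0\<close> to it gives a
    countably infinite set.\<close>
  obtain E0 where E0: "E0 \<subseteq> E" "countable E0" "infinite E0"
    using infinite_countable_subset'[OF \<open>infinite E\<close>] by blast
  define \<phi> where "\<phi> A = {a \<in> E. \<exists>n. j n a \<in> A}" for A
  have countable: "countable (\<phi> A)" if "A \<in> C" for A
  proof -
    have "countable {a \<in> E. j n a \<in> A}" for n
    proof (rule countable_image_inj_on)
      have "j n ` {a \<in> E. j n a \<in> A} \<subseteq> A \<inter> T n"
        using j(2) by blast
      then show "countable (j n ` {a \<in> E. j n a \<in> A})"
        using T(3) C_precompact that countable_subset by blast
      show "inj_on (j n) {a \<in> E. j n a \<in> A}"
        using j(1) by (rule inj_on_subset) auto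
    qed
    moreover have "\<phi> A = (\<Union>n. {a \<in> E. j n a \<in> A})"
      by (auto simp: \<phi>_def)
    ultimately show ?thesis
      by simp
  qed
  have "cofinality (countably_infinite_subsets E) \<le>o |(\<lambda>A. \<phi> A \<union> E0) ` C|"
  proof (rule cofinality_le)
    show "(\<lambda>A. \<phi> A \<union> E0) ` C \<subseteq> countably_infinite_subsets E"
      using E0 countable by (auto simp: countably_infinite_subsets_def \<phi>_def)
    fix B
    assume "B \<in> countably_infinite_subsets E"
    then have B: "B \<subseteq> E" "countable B" "infinite B"
      by (auto simp: countably_infinite_subsets_def)
    \<comment> \<open>The \<open>m\<close>-th element of \<open>B\<close> is moved by the
      \<open>m\<close>-th injection, hence into \<open>V m\<close>. As the enumeration exhausts
      \<open>B\<close>, any \<open>A'\<close> containing \<open>A\<close> has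
      \<open>B \<subseteq> \<phi> A'\<close>.\<close>
    define A where "A = range (\<lambda>m. j m (from_nat_into B m))"
    have b: "from_nat_into B m \<in> B" for m
      using B(3) by (intro from_nat_into) auto
    have "precompact A"
    proof (rule precompact_if_finite_diff)
      fix k
      have "j m (from_nat_into B m) \<in> V k" if "k \<le> m" for m
        using b[of m] B(1) j(2)[of m] T(1)[of m] V_antimono[OF that] by blast
      then have "A - V k \<subseteq> (\<lambda>m. j m (from_nat_into B m)) ` {..<k}"
        unfolding A_def using not_le by blast
      then show "finite (A - V k)"
        by (rule finite_subset) auto
    qed
    then obtain A' where A': "A' \<in> C" "A \<subseteq> A'"
      using C_cofinal by blast
    have "B \<subseteq> \<phi> A'"
    proof
      fix a
      assume a: "a \<in> B"
      then obtain m where "from_nat_into B m = a"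
        using from_nat_into_surj[OF B(2)] by blast
      then have "j m a \<in> A'"
        using A'(2) by (auto simp: A_def)
      then show "a \<in> \<phi> A'"
        using a B(1) by (auto simp: \<phi>_def)
    qed
    then show "\<exists>c\<in>(\<lambda>A. \<phi> A \<union> E0) ` C. B \<le> c"
      using A'(1) by blast
  qed
  then show ?thesis
    using card_of_image by (rule ordLeq_transitive)
qed

end

section \<open>The upper bound\<close>

lemma cofinality_precompact_le:
  fixes D E W :: "'a set" and Y :: "'a set set" and H :: "(nat \<Rightarrow> nat) set"
  assumes D: "closure D = UNIV"
    and W: "0 \<in> interior W" and E: "W \<subseteq> closure E" "infinite E"
    and Y: "Y \<subseteq> countably_infinite_subsets E"
      "\<And>B. B \<in> countably_infinite_subsets E \<Longrightarrow> \<exists>B'\<in>Y. B \<subseteq> B'"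
    and H: "\<And>f. \<exists>h\<in>H. f \<le> h"
  shows "cofinality {A :: 'a set. precompact A} \<le>o |Fpow D \<times> Y \<times> H|"
proof -
  \<comment> \<open>The largest set that, for every \<open>n\<close>, is covered by the
    \<open>V n\<close>-translates centered at the elements of \<open>B\<close> in positions 0 to
    \<open>h n\<close>.\<close>
  define P where "P B h = (\<Inter>n. from_nat_into B ` {..h n} + V n)" for B and h :: "nat \<Rightarrow> nat"
  define \<Phi> where "\<Phi> = (\<lambda>(F, B, h). F + P B h)"
  have P: "precompact (P B h)" for B h
  proof (rule precompactI_base)
    fix n
    show "\<exists>F. finite F \<and> P B h \<subseteq> F + V n"
      by (intro exI[of _ "from_nat_into B ` {..h n}"]) (auto simp: P_def)
  qed
  have "cofinality {A :: 'a set. precompact A} \<le>o |\<Phi> ` (Fpow D \<times> Y \<times> H)|"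
  proof (rule cofinality_le)
    show "\<Phi> ` (Fpow D \<times> Y \<times> H) \<subseteq> {A. precompact A}"
      using P precompact_set_plus_finite by (auto simp: \<Phi>_def Fpow_def)
    fix A :: "'a set"
    assume "A \<in> {A. precompact A}"
    then have A: "precompact A"
      by simp
    obtain F where F: "finite F" "F \<subseteq> D" "A \<subseteq> F + interior W"
      using A D W precompact_dense_cover[of A D "interior W"] by auto
    \<comment> \<open>All pieces of \<open>A\<close> are shifted back into \<open>W\<close>, where
      \<open>E\<close> is dense, so that centers can be taken from \<open>E\<close> instead of
      \<open>D\<close>.\<close>
    define A' where "A' = (uminus ` F + A) \<inter> W"
    have A': "precompact A'" "A' \<subseteq> closure E"
      using precompact_set_plus_finite[of "uminus ` F" A] F(1) A E(1)
      by (auto simp: A'_def intro: precompact_subset)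
    have "\<exists>K. finite K \<and> K \<subseteq> E \<and> A' \<subseteq> K + V n" for n
      using precompact_dense_cover[OF A' open_V zero_in_V] by metis
    then obtain K where K: "\<And>n. finite (K n)" "\<And>n. K n \<subseteq> E" "\<And>n. A' \<subseteq> K n + V n"
      by metis
    \<comment> \<open>The union of the \<open>K n\<close> may be finite; \<open>E0\<close> makes it
      countably infinite.\<close>
    obtain E0 where E0: "E0 \<subseteq> E" "countable E0" "infinite E0"
      using infinite_countable_subset'[OF E(2)] by blast
    have "(\<Union>n. K n) \<union> E0 \<in> countably_infinite_subsets E"
      using K E0 by (auto simp: countably_infinite_subsets_def intro: countable_finite)
    then obtain B where B: "B \<in> Y" "(\<Union>n. K n) \<union> E0 \<subseteq> B"
      using Y(2) by blast
    have "countable B"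
      using B(1) Y(1) by (auto simp: countably_infinite_subsets_def)
    \<comment> \<open>If \<open>K n\<close> is empty this \<open>Max\<close> is unspecified, but
      then there is no position to bound.\<close>
    obtain h where h: "h \<in> H" "(\<lambda>n. Max (to_nat_on B ` K n)) \<le> h"
      using H by blast
    have "K n \<subseteq> from_nat_into B ` {..h n}" for n
    proof
      fix e
      assume e: "e \<in> K n"
      then have "to_nat_on B e \<le> Max (to_nat_on B ` K n)"
        using K(1) by (intro Max_ge) auto
      also have "\<dots> \<le> h n"
        using h(2) by (simp add: le_fun_def)
      finally have "to_nat_on B e \<in> {..h n}"
        by simp
      moreover have "from_nat_into B (to_nat_on B e) = e"
        using e B(2) \<open>countable B\<close> by (intro from_nat_into_to_nat_on) auto
      ultimately show "e \<in> from_nat_into B ` {..h n}"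
        by (metis image_eqI)
    qed
    then have "K n + V n \<subseteq> from_nat_into B ` {..h n} + V n" for n
      by (intro set_plus_mono2) auto
    then have "A' \<subseteq> P B h"
      using K(3) unfolding P_def by blast
    have "A \<subseteq> F + P B h"
    proof
      fix x
      assume x: "x \<in> A"
      then obtain f w where fw: "f \<in> F" "w \<in> interior W" "x = f + w"
        using F(3) by (blast elim: set_plus_elim)
      have "- f + x \<in> uminus ` F + A"
        using fw(1) x by (intro set_plus_intro) auto
      moreover have "- f + x \<in> W"
        using fw(2,3) interior_subset by (auto simp: add.assoc[symmetric])
      ultimately have "- f + x \<in> A'"
        by (simp add: A'_def)
      then have "f + (- f + x) \<in> F + P B h"
        using \<open>A' \<subseteq> P B h\<close> fw(1) by (intro set_plus_intro) auto
      then show "x \<in> F + P B h"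
        by (simp add: add.assoc[symmetric])
    qed
    moreover have "(F, B, h) \<in> Fpow D \<times> Y \<times> H"
      using F B(1) h(1) by (auto simp: Fpow_def)
    ultimately show "\<exists>c\<in>\<Phi> ` (Fpow D \<times> Y \<times> H). A \<le> c"
      by (intro bexI[of _ "\<Phi> (F, B, h)"]) (auto simp: \<Phi>_def)
  qed
  then show ?thesis
    using card_of_image by (rule ordLeq_transitive)
qed

end

section \<open>Infinite densities and the equality of cardinals\<close>

text \<open>A finite dense set would serve as the set of centers for every neighborhood of 0 and
  make \<open>U\<close> precompact.\<close>

lemma infinite_if_dense_in_neighborhood:
  fixes E U :: "'a::topological_group_add set"
  assumes "\<not> locally_precompact TYPE('a)" "0 \<in> interior U" "U \<subseteq> closure E"
  shows "infinite E"
proof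
  assume "finite E"
  then have "precompact U"
    using assms(3) closure_subset_set_plus by (intro precompactI) blast
  then show False
    using assms(1,2) by (auto simp: locally_precompact_def)
qed

theorem theorem1p3:
  assumes "metrizable_space (euclidean :: 'a::topological_group_add topology)"
    and "\<not> locally_precompact TYPE('a::topological_group_add)"
  shows "cofinality {A :: 'a::topological_group_add set. precompact A} =o
    card_max dominating_number
      (card_max (topological_density (euclidean :: 'a topology))
        (cofinality (countably_infinite_subsets (Field (local_density TYPE('a))))))"
proof -
  obtain V :: "nat \<Rightarrow> 'a set" where "countable_zero_base V"
    using assms(1) by (rule metrizable_countable_zero_base)
  then interpret countable_zero_base V .
  obtain W E :: "'a set" where E: "0 \<in> interior W" "E \<subseteq> W" "W \<subseteq> closure E"
    "local_density TYPE('a) = |E|"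
    "\<And>U D :: 'a set. \<lbrakk>0 \<in> interior U; D \<subseteq> U; U \<subseteq> closure D\<rbrakk> \<Longrightarrow> |E| \<le>o |D|"
    by (rule local_density_eq[where 'a = 'a]) blast
  \<comment> \<open>The local density is the cardinal order \<open>|E|\<close> on \<open>E\<close>
    itself, so the countable subsets in question are subsets of \<open>E\<close>.\<close>
  have Field: "Field (local_density TYPE('a)) = E"
    by (simp add: E(4) Field_card_of)
  have "infinite E"
    using assms(2) E(1,3) by (rule infinite_if_dense_in_neighborhood)
  obtain D :: "'a set" where D: "UNIV \<subseteq> closure D"
    "topological_density (top_of_set UNIV) = |D|"
    by (rule topological_density_eq)
  have "infinite D"
    using assms(2) _ D(1) by (rule infinite_if_dense_in_neighborhood) simp
  obtain H :: "(nat \<Rightarrow> nat) set" where H: "\<And>f. \<exists>h\<in>H. f \<le> h" "dominating_number = |H|"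
    unfolding dominating_number_def using cofinality_eq[of "UNIV :: (nat \<Rightarrow> nat) set"] by auto
  obtain Y where Y: "Y \<subseteq> countably_infinite_subsets E"
    "\<And>B. B \<in> countably_infinite_subsets E \<Longrightarrow> \<exists>B'\<in>Y. B \<subseteq> B'"
    "cofinality (countably_infinite_subsets E) = |Y|"
    by (rule cofinality_eq[of "countably_infinite_subsets E"]) blast
  obtain C :: "'a set set" where C: "C \<subseteq> {A. precompact A}"
    "\<And>A. A \<in> {A. precompact A} \<Longrightarrow> \<exists>B\<in>C. A \<subseteq> B" "cofinality {A :: 'a set. precompact A} = |C|"
    by (rule cofinality_eq[of "{A :: 'a set. precompact A}"]) blast
  have C': "\<And>A. A \<in> C \<Longrightarrow> precompact A" "\<And>A. precompact A \<Longrightarrow> \<exists>B\<in>C. A \<subseteq> B"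
    using C(1,2) by auto
  let ?M = "card_max |H| (card_max |D| |Y| )"
  have M: "|H| \<le>o ?M" "|D| \<le>o ?M" "|Y| \<le>o ?M"
  proof -
    show "|H| \<le>o ?M"
      by (rule card_max_ge[OF card_of_Card_order Card_order_card_max])
    have "card_max |D| |Y| \<le>o ?M"
      by (rule card_max_ge[OF card_of_Card_order Card_order_card_max])
    then show "|D| \<le>o ?M" "|Y| \<le>o ?M"
      using card_max_ge[OF card_of_Card_order[of D] card_of_Card_order[of Y]] ordLeq_transitive
      by blast+
  qed
  \<comment> \<open>Being infinite, the maximum absorbs the product of three factors that lie below
    it.\<close>
  have "infinite (Field ?M)"
    using M(2) \<open>infinite D\<close> card_of_ordLeq_infinite card_of_Field_ordIso[OF Card_order_card_max]
    by (metis ordIso_symmetric ordLeq_ordIso_trans)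
  then have "|Fpow D \<times> Y \<times> H| \<le>o ?M"
    using M ordLeq_transitive[OF card_of_Fpow_le[OF \<open>infinite D\<close>] M(2)]
    by (intro card_of_Times_ordLeq_infinite_Field Card_order_card_max)
  moreover have "|C| \<le>o |Fpow D \<times> Y \<times> H|"
    using cofinality_precompact_le[OF _ E(1,3) \<open>infinite E\<close> Y(1,2) H(1), of D] D(1) C(3) by auto
  ultimately have "|C| \<le>o ?M"
    using ordLeq_transitive by blast
  moreover have "?M \<le>o |C|"
  proof (intro card_max_le card_of_Card_order Card_order_card_max)
    show "|H| \<le>o |C|"
      using dominating_number_le[OF C' assms(2)] H(2) by simp
    show "|D| \<le>o |C|"
      using topological_density_le_cofinal[OF C' assms(2)] D(2) by simp
    show "|Y| \<le>o |C|"
      using cofinality_countable_subsets_le[OF C' E(5) \<open>infinite E\<close>] Y(3) by simp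
  qed
  ultimately show ?thesis
    using C(3) H(2) D(2) Y(3) Field by (simp add: ordIso_iff_ordLeq)
qed

end
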